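(* Let $\{(G_t,Y_t)\}_{t\ge 0}$ be a dead-time event detection (DED) process with period $K$, dead time $D$, parameter set $\Theta\subseteq\mathbb R^d$ and event probabilities $p_t(\theta)$. For every $T\in\mathbb N$, define for $r=0,\dots,K-1$ the phasewise counts $$N_r(T)=\sum_{\substack{0\le t<T\\ t\bmod K=r}}G_t,\qquad S_r(T)=\sum_{\substack{0\le t<T\\ t\bmod K=r}}Y_t .$$ Then the vector $H_T=\bigl(N_r(T),S_r(T)\bigr)_{r=0,\dots,K-1}$ is a sufficient statistic for $\theta$ based on the data $X_{0:T-1}=\bigl((G_0,Y_0),\dots,(G_{T-1},Y_{T-1})\bigr)$, i.e. the conditional distribution of $X_{0:T-1}$ given $H_T$ does not depend on $\theta\in\Theta$.
   Context: $\mathbb N=\{0,1,2,\dots\}$. Fix an integer $K\ge 1$ (period), an integer $D\in\mathbb N$ (dead time), and a parameter set $\Theta\subseteq\mathbb R^d$. For each $\theta\in\Theta$ let $p_t(\theta)\in[0,1]$, $t\in\mathbb N$, with $p_{t+K}(\theta)=p_t(\theta)$. A DED process is a stochastic process $\{(G_t,Y_t)\}_{t\ge0}$ with $G_t,Y_t\in\{0,1\}$, whose law under parameter $\theta$ is denoted $P_\theta$, such that: (i) (observation) under $P_\theta$ there are independent $Z_t\sim\mathrm{Ber}(p_t(\theta))$, $t\in\mathbb N$, with $Y_t=G_tZ_t$; (ii) (dead time) almost surely, $Y_t=1$ implies $G_s=0$ for all $s\in\{t+1,\dots,t+D\}$; (iii) (causality) for every $t$ there are $U_t\sim\mathrm{Unif}([0,1])$,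 jointly independent of the event sequence $\{Z_s\}_{s\ge0}$ and the past observations $\{(G_s,Y_s)\}_{s=0}^{t-1}$, and a measurable map $\Phi_t:\{0,1\}^{2t}\times[0,1]\to\{0,1\}$, not depending on $\theta$, such that $G_t=\Phi_t(G_0,Y_0,\dots,G_{t-1},Y_{t-1},U_t)$ a.s.; (iv) (gating-frequency convergence) for every $\theta\in\Theta$ there is $\gamma(\theta)\in[0,1]^K$ such that for each $r=0,\dots,K-1$, $\frac1L\sum_{\ell=0}^{L-1}G_{r+\ell K}\to\gamma_r(\theta)$ in $P_\theta$-probability as $L\to\infty$. *)

theory Defs
  imports "HOL-Probability.Probability"
begin

text \<open>
  The values 0 and 1 of \<open>G\<close>, \<open>Y\<close>, \<open>Z\<close> are encoded as booleans, so that \<open>G Z\<close> becomes a conjunction.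
\<close>

definition observations ::
  "(nat \<Rightarrow> 'w \<Rightarrow> bool) \<Rightarrow> (nat \<Rightarrow> 'w \<Rightarrow> bool) \<Rightarrow> nat \<Rightarrow> 'w \<Rightarrow> (bool \<times> bool) list" where
  "observations G Y t \<omega> = map (\<lambda>s. (G s \<omega>, Y s \<omega>)) [0..<t]"

definition tendsto_in_prob :: "'w measure \<Rightarrow> (nat \<Rightarrow> 'w \<Rightarrow> real) \<Rightarrow> real \<Rightarrow> bool" where
  "tendsto_in_prob M A a \<longleftrightarrow>
     (\<forall>\<epsilon>>0. (\<lambda>n. measure M {\<omega> \<in> space M. \<bar>A n \<omega> - a\<bar> > \<epsilon>}) \<longlonglongrightarrow> 0)"

text \<open>
  The constant \<open>prob_space.indep_var\<close> forces both variables to have the same value type; this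
  is its heterogeneous counterpart.
\<close>

definition independent_rvs ::
  "'w measure \<Rightarrow> 'a measure \<Rightarrow> ('w \<Rightarrow> 'a) \<Rightarrow> 'b measure \<Rightarrow> ('w \<Rightarrow> 'b) \<Rightarrow> bool" where
  "independent_rvs M MA A MB B \<longleftrightarrow> A \<in> M \<rightarrow>\<^sub>M MA \<and> B \<in> M \<rightarrow>\<^sub>M MB \<and>
     prob_space.indep_set M (sets (vimage_algebra (space M) A MA)) (sets (vimage_algebra (space M) B MB))"

text \<open>
  The statistical model is a measurable space \<open>F\<close> with a family \<open>P \<theta>\<close> of probability measures
  on it; \<open>G\<close> and \<open>Y\<close> are fixed random variables. The auxiliary variables \<open>Z\<close> and \<open>U\<close> may depend
  on \<open>\<theta>\<close>, whereas the maps \<open>\<Phi> t\<close> are chosen before \<open>\<theta>\<close>.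
  In the causality condition, \<open>U t\<close> is independent of the pair consisting of the whole sequence
  \<open>Z\<close> and the past observations (these two are in general dependent on each other).
\<close>

locale DED_process =
  fixes F :: "'w measure"
    and K D :: nat
    and \<Theta> :: "(real ^ 'd) set"
    and p :: "nat \<Rightarrow> real ^ 'd \<Rightarrow> real"
    and P :: "real ^ 'd \<Rightarrow> 'w measure"
    and G Y :: "nat \<Rightarrow> 'w \<Rightarrow> bool"
  assumes period_pos: "K \<ge> 1"
    and p_range: "\<And>\<theta> t. \<theta> \<in> \<Theta> \<Longrightarrow> p t \<theta> \<in> {0..1}"
    and p_periodic: "\<And>\<theta> t. \<theta> \<in> \<Theta> \<Longrightarrow> p (t + K) \<theta> = p t \<theta>"
    and prob_space_P: "\<And>\<theta>. \<theta> \<in> \<Theta> \<Longrightarrow> prob_space (P \<theta>)"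
    and sets_P: "\<And>\<theta>. \<theta> \<in> \<Theta> \<Longrightarrow> sets (P \<theta>) = sets F"
    and G_measurable: "\<And>t. G t \<in> F \<rightarrow>\<^sub>M count_space UNIV"
    and Y_measurable: "\<And>t. Y t \<in> F \<rightarrow>\<^sub>M count_space UNIV"
    and observation_causality:
      "\<exists>\<Phi> :: nat \<Rightarrow> (bool \<times> bool) list \<times> real \<Rightarrow> bool.
         (\<forall>t. \<Phi> t \<in> count_space {h. length h = t} \<Otimes>\<^sub>M restrict_space borel {0..1}
                 \<rightarrow>\<^sub>M count_space UNIV) \<and>
         (\<forall>\<theta>\<in>\<Theta>. \<exists>(Z :: nat \<Rightarrow> 'w \<Rightarrow> bool) (U :: nat \<Rightarrow> 'w \<Rightarrow> real).
            prob_space.indep_vars (P \<theta>) (\<lambda>_. count_space UNIV) Z UNIV \<and>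
            (\<forall>t. distr (P \<theta>) (count_space UNIV) (Z t) = measure_pmf (bernoulli_pmf (p t \<theta>))) \<and>
            (\<forall>t. AE \<omega> in P \<theta>. Y t \<omega> \<longleftrightarrow> G t \<omega> \<and> Z t \<omega>) \<and>
            (\<forall>t. U t \<in> borel_measurable (P \<theta>)) \<and>
            (\<forall>t. distr (P \<theta>) borel (U t) = uniform_measure lborel {0..1}) \<and>
            (\<forall>t. independent_rvs (P \<theta>) borel (U t)
                   ((\<Pi>\<^sub>M s\<in>UNIV. count_space UNIV) \<Otimes>\<^sub>M count_space UNIV)
                   (\<lambda>\<omega>. (\<lambda>s. Z s \<omega>, observations G Y t \<omega>))) \<and>
            (\<forall>t. AE \<omega> in P \<theta>. G t \<omega> = \<Phi> t (observations G Y t \<omega>, U t \<omega>)))"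
    and dead_time:
      "\<And>\<theta> t. \<theta> \<in> \<Theta> \<Longrightarrow> AE \<omega> in P \<theta>. Y t \<omega> \<longrightarrow> (\<forall>s\<in>{t+1..t+D}. \<not> G s \<omega>)"
    and gating_frequency:
      "\<And>\<theta>. \<theta> \<in> \<Theta> \<Longrightarrow>
         \<exists>\<gamma> :: nat \<Rightarrow> real. \<forall>r<K. \<gamma> r \<in> {0..1} \<and>
           tendsto_in_prob (P \<theta>) (\<lambda>L \<omega>. (\<Sum>l<L. of_bool (G (r + l * K) \<omega>)) / real L) (\<gamma> r)"

definition phase_count :: "nat \<Rightarrow> (nat \<Rightarrow> 'w \<Rightarrow> bool) \<Rightarrow> nat \<Rightarrow> nat \<Rightarrow> 'w \<Rightarrow> nat" where
  "phase_count K A r T \<omega> = (\<Sum>t\<in>{t. t < T \<and> t mod K = r}. of_bool (A t \<omega>))"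

definition phase_counts ::
  "nat \<Rightarrow> (nat \<Rightarrow> 'w \<Rightarrow> bool) \<Rightarrow> (nat \<Rightarrow> 'w \<Rightarrow> bool) \<Rightarrow> nat \<Rightarrow> 'w \<Rightarrow> (nat \<times> nat) list" where
  "phase_counts K G Y T \<omega> = map (\<lambda>r. (phase_count K G r T \<omega>, phase_count K Y r T \<omega>)) [0..<K]"

text \<open>
  Sufficiency of \<open>H\<close> for the family \<open>P\<close> based on the data \<open>X\<close>: \<open>H\<close> is a measurable function of
  \<open>X\<close>, and a single Markov kernel \<open>\<kappa>\<close> is, for every \<open>\<theta>\<close>, a regular conditional distribution of \<open>X\<close>
  given \<open>H\<close> under \<open>P \<theta>\<close>. The conditional probabilities are taken with respect to the
  \<open>\<sigma>\<close>-algebra generated by \<open>H\<close>.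
\<close>

definition sufficient_statistic ::
  "'p set \<Rightarrow> 'w measure \<Rightarrow> ('p \<Rightarrow> 'w measure) \<Rightarrow>
   'x measure \<Rightarrow> ('w \<Rightarrow> 'x) \<Rightarrow> 'h measure \<Rightarrow> ('w \<Rightarrow> 'h) \<Rightarrow> bool" where
  "sufficient_statistic \<Theta> F P MX X MH H \<longleftrightarrow>
     X \<in> F \<rightarrow>\<^sub>M MX \<and>
     (\<exists>h \<in> MX \<rightarrow>\<^sub>M MH. \<forall>\<omega>\<in>space F. H \<omega> = h (X \<omega>)) \<and>
     (\<exists>\<kappa> \<in> MH \<rightarrow>\<^sub>M prob_algebra MX. \<forall>\<theta>\<in>\<Theta>. \<forall>A\<in>sets MX.
        AE \<omega> in P \<theta>.
          real_cond_exp (P \<theta>) (vimage_algebra (space F) H MH)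
            (indicator (X -` A \<inter> space F)) \<omega> = measure (\<kappa> (H \<omega>)) A)"

end

theory Submission
  imports Defs
begin

text \<open>
  The likelihood of a path \<open>x = ((g\<^sub>0, y\<^sub>0), (g\<^sub>1, y\<^sub>1), \<dots>)\<close> factors into the probabilities that \<open>\<Phi> t\<close> produces \<open>g\<^sub>t\<close> from the past of \<open>x\<close>, which are free of \<open>\<theta>\<close>,
  and the probabilities that \<open>y\<^sub>t = g\<^sub>t Z\<^sub>t\<close>. By periodicity the latter depend on \<open>x\<close> only through
  the phasewise counts, so the Fisher--Neyman factorization criterion applies.
\<close>

section \<open>The factorization criterion on a finite space\<close>

text \<open>On a finite range, \<open>f (X \<omega>)\<close> is a linear combination of indicators
  of the fibres of \<open>X\<close>. All integrals in the factorization criterion thereby become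
  finite sums over \<open>S\<close>.\<close>

lemma (in prob_space) integral_finite_valued:
  fixes f :: "'b \<Rightarrow> real"
  assumes "finite S" and X: "X \<in> M \<rightarrow>\<^sub>M count_space S"
  shows "integrable M (\<lambda>\<omega>. f (X \<omega>))"
    and "(\<integral>\<omega>. f (X \<omega>) \<partial>M) = (\<Sum>x\<in>S. f x * prob (X -` {x} \<inter> space M))"
proof -
  have ev: "X -` {x} \<inter> space M \<in> events" if "x \<in> S" for x
    using measurable_sets[OF X, of "{x}"] that by simp
  have eq: "f (X \<omega>) = (\<Sum>x\<in>S. f x * indicator (X -` {x} \<inter> space M) \<omega>)" if "\<omega> \<in> space M" for \<omega>
  proof -
    have "X \<omega> \<in> S"
      using measurable_space[OF X that] by simp
    then show ?thesis
      using that \<open>finite S\<close> by (simp add: indicator_def if_distrib cong: if_cong)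
  qed
  have int: "integrable M (\<lambda>\<omega>. f x * indicator (X -` {x} \<inter> space M) \<omega>)" if "x \<in> S" for x
    using ev[OF that] by (simp add: emeasure_eq_measure)
  have "integrable M (\<lambda>\<omega>. \<Sum>x\<in>S. f x * indicator (X -` {x} \<inter> space M) \<omega>)"
    using int by (rule Bochner_Integration.integrable_sum)
  then show "integrable M (\<lambda>\<omega>. f (X \<omega>))"
    by (subst Bochner_Integration.integrable_cong[OF refl eq]) auto
  have "(\<integral>\<omega>. f (X \<omega>) \<partial>M) = (\<integral>\<omega>. (\<Sum>x\<in>S. f x * indicator (X -` {x} \<inter> space M) \<omega>) \<partial>M)"
    by (rule Bochner_Integration.integral_cong[OF refl eq])
  also have "\<dots> = (\<Sum>x\<in>S. f x * prob (X -` {x} \<inter> space M))"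
    using int by (subst Bochner_Integration.integral_sum) (auto intro!: sum.cong simp: Int_absorb2)
  finally show "(\<integral>\<omega>. f (X \<omega>) \<partial>M) = (\<Sum>x\<in>S. f x * prob (X -` {x} \<inter> space M))" .
qed

section \<open>The conditional law on the fibres of the statistic\<close>

text \<open>On fibres of total weight 0 the conditional law is an arbitrary point mass.\<close>

definition fibre_weight :: "'x set \<Rightarrow> ('x \<Rightarrow> 'h) \<Rightarrow> ('x \<Rightarrow> real) \<Rightarrow> 'h \<Rightarrow> 'x \<Rightarrow> real" where
  "fibre_weight S h c v x =
     (let C = (\<Sum>x'\<in>{x' \<in> S. h x' = v}. c x') in
      if C = 0 then of_bool (x = (SOME s. s \<in> S)) else of_bool (h x = v) * c x / C)"

lemma fibre_weight_nonneg:
  assumes "\<And>x. x \<in> S \<Longrightarrow> 0 \<le> c x" "x \<in> S"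
  shows "0 \<le> fibre_weight S h c v x"
  using assms by (auto simp: fibre_weight_def Let_def intro!: divide_nonneg_nonneg sum_nonneg)

lemma sum_fibre_weight:
  assumes "finite S" "S \<noteq> {}"
  shows "(\<Sum>x\<in>S. fibre_weight S h c v x) = 1"
proof (cases "(\<Sum>x'\<in>{x' \<in> S. h x' = v}. c x') = 0")
  case True
  have "(SOME s. s \<in> S) \<in> S"
    using assms(2) by (simp add: some_in_eq)
  then show ?thesis
    using True assms(1) by (simp add: fibre_weight_def of_bool_def)
next
  case False
  have "(\<Sum>x\<in>S. of_bool (h x = v) * c x) = (\<Sum>x'\<in>{x' \<in> S. h x' = v}. c x')"
    using assms(1) by (intro sum.mono_neutral_cong_right) auto
  then show ?thesis
    using False by (simp add: fibre_weight_def flip: sum_divide_distrib)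
qed

text \<open>Only points of the fibre of \<open>x\<close> contribute, where \<open>k\<close> is
  constant and the sum of \<open>c\<close> cancels the normalizing constant. So spreading the mass
  of each fibre according to \<open>fibre_weight\<close> restores the original masses. This is the
  defining property of the conditional law as an identity of finite sums.\<close>

lemma fibre_weight_disintegration:
  assumes "finite S" and c: "\<And>x. x \<in> S \<Longrightarrow> 0 \<le> c x" and "x \<in> S"
  shows "(\<Sum>x'\<in>S. k (h x') * c x' * fibre_weight S h c (h x') x) = k (h x) * c x"
proof -
  define C where "C v = (\<Sum>x'\<in>{x' \<in> S. h x' = v}. c x')" for v
  \<comment> \<open>By nonnegativity a fibre of total weight 0 contains only points of weight 0.
    Hence the default point mass contributes nothing, and the division by \<open>C (h x)\<close>
    below is harmless even if \<open>C (h x) = 0\<close>.\<close>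
  have zero: "c x' = 0" if "x' \<in> S" "C (h x') = 0" for x'
  proof -
    have "\<forall>y\<in>{y \<in> S. h y = h x'}. c y = 0"
      using that(2) c assms(1) unfolding C_def by (subst (asm) sum_nonneg_eq_0_iff) auto
    then show ?thesis using that(1) by simp
  qed
  have "(\<Sum>x'\<in>S. k (h x') * c x' * fibre_weight S h c (h x') x)
      = (\<Sum>x'\<in>{x' \<in> S. h x' = h x}. c x' * (k (h x) * c x / C (h x)))"
    using assms(1) zero
    by (intro sum.mono_neutral_cong_right)
       (auto simp: fibre_weight_def Let_def C_def[symmetric])
  also have "\<dots> = C (h x) * (k (h x) * c x / C (h x))"
    unfolding sum_distrib_right[symmetric] C_def ..
  also have "\<dots> = k (h x) * c x"
    using zero[OF assms(3)] by simp
  finally show ?thesis .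
qed

text \<open>On a fibre of \<open>h\<close> the factor \<open>q \<theta>\<close> is constant and
  cancels on normalization, which leaves weights proportional to \<open>c\<close>. That these give
  the conditional law is checked by integrating over the events generated by
  \<open>H\<close>.\<close>

theorem fisher_neyman_factorization:
  fixes c :: "'x \<Rightarrow> real" and q :: "'p \<Rightarrow> 'h \<Rightarrow> real"
  assumes S: "finite S" "S \<noteq> {}"
    and X: "X \<in> F \<rightarrow>\<^sub>M count_space S"
    and h: "h \<in> count_space S \<rightarrow>\<^sub>M count_space V"
    and H: "\<And>\<omega>. \<omega> \<in> space F \<Longrightarrow> H \<omega> = h (X \<omega>)"
    and P: "\<And>\<theta>. \<theta> \<in> \<Theta> \<Longrightarrow> prob_space (P \<theta>)" "\<And>\<theta>. \<theta> \<in> \<Theta> \<Longrightarrow> sets (P \<theta>) = sets F"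
    and c: "\<And>x. x \<in> S \<Longrightarrow> 0 \<le> c x"
    and factor: "\<And>\<theta> x. \<theta> \<in> \<Theta> \<Longrightarrow> x \<in> S \<Longrightarrow> measure (P \<theta>) (X -` {x} \<inter> space F) = c x * q \<theta> (h x)"
  shows "sufficient_statistic \<Theta> F P (count_space S) X (count_space V) H"
proof -
  let ?w = "fibre_weight S h c"
  \<comment> \<open>The kernel is built from \<open>c\<close> alone, hence is common to all
    \<theta>. The default point mass makes it a probability measure for every \<open>v\<close>, also
    where no fibre mass exists.\<close>
  define \<kappa> where "\<kappa> v = point_measure S (\<lambda>x. ennreal (?w v x))" for v
  have measure_\<kappa>: "measure (\<kappa> v) A = (\<Sum>x\<in>A. ?w v x)" if "A \<subseteq> S" for v A
  proof -
    have "emeasure (\<kappa> v) A = (\<Sum>x\<in>A. ennreal (?w v x))"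
      unfolding \<kappa>_def using S(1) that by (rule emeasure_point_measure_finite)
    also have "\<dots> = ennreal (\<Sum>x\<in>A. ?w v x)"
      using that c by (intro sum_ennreal) (auto intro: fibre_weight_nonneg)
    finally show ?thesis
      using that c by (auto simp: measure_def intro!: enn2real_ennreal sum_nonneg fibre_weight_nonneg)
  qed
  have \<kappa>: "\<kappa> \<in> count_space V \<rightarrow>\<^sub>M prob_algebra (count_space S)"
  proof -
    have "prob_space (\<kappa> v)" for v
    proof
      have "emeasure (\<kappa> v) S = (\<Sum>x\<in>S. ennreal (?w v x))"
        unfolding \<kappa>_def using S(1) by (rule emeasure_point_measure_finite) simp
      also have "\<dots> = ennreal (\<Sum>x\<in>S. ?w v x)"
        using c by (intro sum_ennreal) (auto intro: fibre_weight_nonneg)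
      finally show "emeasure (\<kappa> v) (space (\<kappa> v)) = 1"
        by (simp add: sum_fibre_weight[OF S]) (simp add: \<kappa>_def space_point_measure)
    qed
    then show ?thesis
      by (auto simp: space_prob_algebra \<kappa>_def sets_point_measure)
  qed
  have "AE \<omega> in P \<theta>. real_cond_exp (P \<theta>) (vimage_algebra (space F) H (count_space V))
            (indicator (X -` A \<inter> space F)) \<omega> = measure (\<kappa> (H \<omega>)) A"
    if \<theta>: "\<theta> \<in> \<Theta>" and A: "A \<in> sets (count_space S)" for \<theta> A
  proof -
    interpret prob_space "P \<theta>" by (rule P) fact
    have sp: "space (P \<theta>) = space F"
      using P(2)[OF \<theta>] by (rule sets_eq_imp_space_eq)
    have AS: "A \<subseteq> S" using A by simp
    have X': "X \<in> P \<theta> \<rightarrow>\<^sub>M count_space S"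
      using X P(2)[OF \<theta>] by (simp cong: measurable_cong_sets)
    have H': "H \<in> P \<theta> \<rightarrow>\<^sub>M count_space V"
      using measurable_compose[OF X' h] by (rule measurable_cong[THEN iffD1, rotated]) (simp add: sp H)
    let ?A = "vimage_algebra (space F) H (count_space V)"
    have HV: "H \<in> space F \<rightarrow> V"
      using measurable_space[OF H'] by (auto simp: sp)
    have sub: "subalgebra (P \<theta>) ?A"
      unfolding subalgebra_def using measurable_sets[OF H'] HV by (auto simp: sp sets_vimage_algebra2)
    interpret finite_measure_subalgebra "P \<theta>" ?A
      by unfold_locales (rule sub)
    have split: "indicator (X -` A \<inter> space F) \<omega> = (indicator A (X \<omega>) :: real)" if "\<omega> \<in> space (P \<theta>)" for \<omega>
      using that by (simp add: indicator_def sp)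
    show ?thesis
    proof (rule real_cond_exp_charact)
      fix B assume "B \<in> sets ?A"
      \<comment> \<open>An event of the generated \<sigma>-algebra is a preimage under
        \<open>H\<close>, so its indicator is a function of \<open>X\<close> through
        \<open>h\<close>.\<close>
      then obtain E where E: "E \<subseteq> V" "B = H -` E \<inter> space F"
        using HV by (auto simp: sets_vimage_algebra2)
      let ?e = "\<lambda>x. indicator E (h x) :: real"
      have ind: "indicator B \<omega> = ?e (X \<omega>)" if "\<omega> \<in> space (P \<theta>)" for \<omega>
        using that by (simp add: E H indicator_def sp)
      have "(LINT \<omega>:B|P \<theta>. indicator (X -` A \<inter> space F) \<omega>) = (\<integral>\<omega>. ?e (X \<omega>) * indicator A (X \<omega>) \<partial>P \<theta>)"
        unfolding set_lebesgue_integral_def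
        by (intro Bochner_Integration.integral_cong) (auto simp: ind split)
      also have "\<dots> = (\<Sum>x\<in>S. ?e x * indicator A x * (c x * q \<theta> (h x)))"
        using integral_finite_valued(2)[OF S(1) X', of "\<lambda>x. ?e x * indicator A x"]
        by (simp add: factor[OF \<theta>] sp)
      also have "\<dots> = (\<Sum>x\<in>A. (?e x * q \<theta> (h x)) * c x)"
        using S(1) AS by (intro sum.mono_neutral_cong_right) (auto simp: indicator_def)
      \<comment> \<open>Disintegration with \<open>k\<close> the product of the indicator of
        \<open>E\<close> and \<open>q \<theta>\<close>. After the exchange of sums, the inner sum
        over \<open>A\<close> is the kernel measure of \<open>A\<close>.\<close>
      also have "\<dots> = (\<Sum>x\<in>A. \<Sum>x'\<in>S. ?e x' * q \<theta> (h x') * c x' * ?w (h x') x)"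
        using AS c
        by (intro sum.cong refl fibre_weight_disintegration[OF S(1), where h=h and
              k="\<lambda>v. indicator E v * q \<theta> v", symmetric]) auto
      also have "\<dots> = (\<Sum>x'\<in>S. \<Sum>x\<in>A. ?e x' * q \<theta> (h x') * c x' * ?w (h x') x)"
        by (rule sum.swap)
      also have "\<dots> = (\<Sum>x\<in>S. ?e x * measure (\<kappa> (h x)) A * (c x * q \<theta> (h x)))"
        by (simp add: measure_\<kappa>[OF AS] sum_distrib_left mult_ac)
      also have "\<dots> = (\<integral>\<omega>. ?e (X \<omega>) * measure (\<kappa> (h (X \<omega>))) A \<partial>P \<theta>)"
        using integral_finite_valued(2)[OF S(1) X', of "\<lambda>x. ?e x * measure (\<kappa> (h x)) A"]
        by (simp add: factor[OF \<theta>] sp)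
      also have "\<dots> = (LINT \<omega>:B|P \<theta>. measure (\<kappa> (H \<omega>)) A)"
        unfolding set_lebesgue_integral_def
        by (intro Bochner_Integration.integral_cong) (auto simp: ind H sp)
      finally show "(LINT \<omega>:B|P \<theta>. indicator (X -` A \<inter> space F) \<omega>) = (LINT \<omega>:B|P \<theta>. measure (\<kappa> (H \<omega>)) A)" .
    next
      show "integrable (P \<theta>) (indicator (X -` A \<inter> space F) :: _ \<Rightarrow> real)"
        using integral_finite_valued(1)[OF S(1) X', of "indicator A"]
        by (subst Bochner_Integration.integrable_cong[OF refl split]) auto
      show "integrable (P \<theta>) (\<lambda>\<omega>. measure (\<kappa> (H \<omega>)) A)"
        using integral_finite_valued(1)[OF S(1) X', of "\<lambda>x. measure (\<kappa> (h x)) A"]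
        by (rule Bochner_Integration.integrable_cong[THEN iffD1, rotated 2]) (auto simp: H sp)
      have "H \<in> ?A \<rightarrow>\<^sub>M count_space V"
        using HV by (intro measurable_vimage_algebra1) simp
      then show "(\<lambda>\<omega>. measure (\<kappa> (H \<omega>)) A) \<in> borel_measurable ?A"
        by (rule measurable_compose) simp
    qed
  qed
  moreover have "\<exists>h \<in> count_space S \<rightarrow>\<^sub>M count_space V. \<forall>\<omega>\<in>space F. H \<omega> = h (X \<omega>)"
    using h H by blast
  ultimately show ?thesis
    unfolding sufficient_statistic_def using X \<kappa> by blast
qed

section \<open>The likelihood of an observed path\<close>

lemma independent_rvs_prob:
  assumes "prob_space M" "independent_rvs M MA A MB B" "E \<in> sets MA" "C \<in> sets MB"
  shows "measure M {\<omega> \<in> space M. A \<omega> \<in> E \<and> B \<omega> \<in> C}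
       = measure M {\<omega> \<in> space M. A \<omega> \<in> E} * measure M {\<omega> \<in> space M. B \<omega> \<in> C}"
proof -
  interpret prob_space M by fact
  have "prob ((A -` E \<inter> space M) \<inter> (B -` C \<inter> space M)) = prob (A -` E \<inter> space M) * prob (B -` C \<inter> space M)"
    using assms(2-4) unfolding independent_rvs_def
    by (intro indep_setD) (auto intro: in_vimage_algebra)
  then show ?thesis
    by (simp add: vimage_def Int_def conj_ac)
qed

text \<open>The restriction to the unit interval is essential to the encoding: measurability of
  \<open>\<Phi> t\<close> is only assumed for noise values there.\<close>

definition gate_set :: "(nat \<Rightarrow> (bool \<times> bool) list \<times> real \<Rightarrow> bool) \<Rightarrow> (bool \<times> bool) list \<Rightarrow> bool \<Rightarrow> real set" where
  "gate_set \<Phi> x g = {u \<in> {0..1}. \<Phi> (length x) (x, u) = g}"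

text \<open>The gating factor of the likelihood. The second components of \<open>x\<close> enter
  only as part of the past seen by later gates.\<close>

definition gate_prob :: "(nat \<Rightarrow> (bool \<times> bool) list \<times> real \<Rightarrow> bool) \<Rightarrow> (bool \<times> bool) list \<Rightarrow> real" where
  "gate_prob \<Phi> x =
     (\<Prod>s<length x. measure (uniform_measure lborel {0..1}) (gate_set \<Phi> (take s x) (fst (x ! s))))"

lemma gate_prob_append:
  "gate_prob \<Phi> (x @ [a]) =
     gate_prob \<Phi> x * measure (uniform_measure lborel {0..1}) (gate_set \<Phi> x (fst a))"
  by (simp add: gate_prob_def nth_append)

lemma gate_set_borel:
  assumes "\<Phi> (length x) \<in> count_space {h. length h = length x} \<Otimes>\<^sub>M restrict_space borel {0..1}
              \<rightarrow>\<^sub>M count_space UNIV"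
  shows "gate_set \<Phi> x g \<in> sets borel"
proof -
  have "(\<lambda>u. \<Phi> (length x) (x, u)) \<in> restrict_space borel {0..1} \<rightarrow>\<^sub>M count_space UNIV"
    using assms by (rule measurable_Pair2) simp
  from measurable_sets[OF this, of "{g}"]
  have "gate_set \<Phi> x g \<in> sets (restrict_space borel {0..1})"
    by (simp add: gate_set_def vimage_def Int_def space_restrict_space conj_commute)
  then show ?thesis
    by (subst (asm) sets_restrict_space_iff) auto
qed

section \<open>Observed paths and their joint law with the event sequence\<close>

lemma observations_Suc:
  "observations G Y (Suc t) \<omega> = observations G Y t \<omega> @ [(G t \<omega>, Y t \<omega>)]"
  by (simp add: observations_def)

lemma observations_measurable:
  assumes "\<And>t. G t \<in> F \<rightarrow>\<^sub>M count_space UNIV" "\<And>t. Y t \<in> F \<rightarrow>\<^sub>M count_space UNIV"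
  shows "observations G Y t \<in> F \<rightarrow>\<^sub>M count_space {x. length x = t}"
proof (induction t)
  case 0
  then show ?case by (simp add: observations_def)
next
  case (Suc t)
  let ?L = "{x :: (bool \<times> bool) list. length x = t}"
  have "(\<lambda>\<omega>. (observations G Y t \<omega>, G t \<omega>, Y t \<omega>)) \<in> F \<rightarrow>\<^sub>M
           count_space ?L \<Otimes>\<^sub>M (count_space UNIV \<Otimes>\<^sub>M count_space UNIV)"
    using Suc assms by (intro measurable_Pair)
  \<comment> \<open>Both factors are countable, so the product \<sigma>-algebra is discrete and
    appending is trivially measurable.\<close>
  also have "count_space ?L \<Otimes>\<^sub>M (count_space UNIV \<Otimes>\<^sub>M count_space UNIV)
      = count_space (?L \<times> (UNIV :: (bool \<times> bool) set))"
    by (simp add: pair_measure_countable)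
  finally have "(\<lambda>\<omega>. (\<lambda>(x, a). x @ [a]) (observations G Y t \<omega>, G t \<omega>, Y t \<omega>)) \<in> F \<rightarrow>\<^sub>M
      count_space {x. length x = Suc t}"
    by (rule measurable_compose) auto
  then show ?case by (simp add: observations_Suc[abs_def])
qed

text \<open>
  The event \<open>B\<close> about the whole sequence \<open>Z\<close> makes the induction go through: the constraint
  \<open>y\<^sub>t = g\<^sub>t Z\<^sub>t\<close> of the last step is absorbed into it, so the noise \<open>U t\<close> only has to be
  independent of \<open>Z\<close> and the past, and nothing is needed about the joint law of the \<open>U t\<close>.
\<close>

lemma (in prob_space) prob_path_and_events:
  fixes Z :: "nat \<Rightarrow> 'a \<Rightarrow> bool" and U :: "nat \<Rightarrow> 'a \<Rightarrow> real"
  assumes \<Phi>: "\<And>t. \<Phi> t \<in> count_space {h. length h = t} \<Otimes>\<^sub>M restrict_space borel {0..1} \<rightarrow>\<^sub>M count_space UNIV"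
    and G: "\<And>t. G t \<in> M \<rightarrow>\<^sub>M count_space UNIV" and Y: "\<And>t. Y t \<in> M \<rightarrow>\<^sub>M count_space UNIV"
    and Z: "\<And>t. Z t \<in> M \<rightarrow>\<^sub>M count_space UNIV"
    and obs: "\<And>t. AE \<omega> in M. Y t \<omega> \<longleftrightarrow> G t \<omega> \<and> Z t \<omega>"
    and U: "\<And>t. U t \<in> borel_measurable M"
    and unif: "\<And>t. distr M borel (U t) = uniform_measure lborel {0..1}"
    and ind: "\<And>t. independent_rvs M borel (U t)
                ((\<Pi>\<^sub>M s\<in>UNIV. count_space UNIV) \<Otimes>\<^sub>M count_space UNIV)
                (\<lambda>\<omega>. (\<lambda>s. Z s \<omega>, observations G Y t \<omega>))"
    and gate: "\<And>t. AE \<omega> in M. G t \<omega> = \<Phi> t (observations G Y t \<omega>, U t \<omega>)"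
    and B: "B \<in> sets (\<Pi>\<^sub>M s\<in>UNIV. count_space UNIV)"
  shows "prob {\<omega> \<in> space M. observations G Y (length x) \<omega> = x \<and> (\<lambda>s. Z s \<omega>) \<in> B} =
    gate_prob \<Phi> x * prob {\<omega> \<in> space M. (\<lambda>s. Z s \<omega>) \<in> B \<and>
                           (\<forall>s<length x. snd (x ! s) = (fst (x ! s) \<and> Z s \<omega>))}"
  using B
proof (induction x arbitrary: B rule: rev_induct)
  case Nil
  then show ?case by (simp add: gate_prob_def observations_def)
next
  case (snoc a x)
  obtain g y where a: "a = (g, y)" by (cases a)
  let ?t = "length x" and ?PM = "\<Pi>\<^sub>M s\<in>(UNIV :: nat set). count_space (UNIV :: bool set)"
  let ?O = "observations G Y ?t" and ?\<mu> = "uniform_measure lborel {0..1::real}"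
  define B' where "B' = {z \<in> B. y = (g \<and> z ?t)}"
  have "(\<lambda>z. z ?t) \<in> ?PM \<rightarrow>\<^sub>M count_space UNIV"
    by (rule measurable_component_singleton) simp
  from measurable_sets[OF this, of "{b. y = (g \<and> b)}"]
  have "(\<lambda>z. z ?t) -` {b. y = (g \<and> b)} \<inter> space ?PM \<in> sets ?PM" by simp
  then have "B \<inter> ((\<lambda>z. z ?t) -` {b. y = (g \<and> b)} \<inter> space ?PM) \<in> sets ?PM"
    using snoc.prems by (rule sets.Int[rotated])
  also have "B \<inter> ((\<lambda>z. z ?t) -` {b. y = (g \<and> b)} \<inter> space ?PM) = B'"
    using sets.sets_into_space[OF snoc.prems] by (auto simp: B'_def)
  finally have B': "B' \<in> sets ?PM" .
  have E: "gate_set \<Phi> x g \<in> sets borel"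
    by (rule gate_set_borel) (rule \<Phi>)
  have C: "B' \<times> {x} \<in> sets (?PM \<Otimes>\<^sub>M count_space UNIV)"
    using B' by (intro pair_measureI) auto
  have W: "(\<lambda>\<omega>. (\<lambda>s. Z s \<omega>, ?O \<omega>)) \<in> M \<rightarrow>\<^sub>M ?PM \<Otimes>\<^sub>M count_space UNIV"
    using ind[of ?t] by (simp add: independent_rvs_def)
  have Zm: "(\<lambda>\<omega> s. Z s \<omega>) \<in> M \<rightarrow>\<^sub>M ?PM"
    using measurable_compose[OF W measurable_fst] by simp
  have Om: "observations G Y t \<in> M \<rightarrow>\<^sub>M count_space {x. length x = t}" for t
    using G Y by (rule observations_measurable)
  \<comment> \<open>Needed because \<open>gate_set\<close> ignores noise values outside the unit
    interval.\<close>
  have unit: "AE \<omega> in M. U ?t \<omega> \<in> {0..1}"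
  proof -
    have "AE u in distr M borel (U ?t). u \<in> {0..1}"
      unfolding unif by (rule AE_uniform_measureI) auto
    then show ?thesis
      using U by (subst (asm) AE_distr_iff) auto
  qed
  have s1: "{\<omega> \<in> space M. observations G Y (length (x @ [a])) \<omega> = x @ [a] \<and> (\<lambda>s. Z s \<omega>) \<in> B} \<in> events"
  proof -
    have "observations G Y (length (x @ [a])) -` {x @ [a]} \<inter> space M \<in> events"
      by (rule measurable_sets[OF Om]) simp
    from sets.Int[OF this measurable_sets[OF Zm snoc.prems]] show ?thesis
      by (rule back_subst[where P="\<lambda>A. A \<in> events"]) auto
  qed
  have s2: "{\<omega> \<in> space M. U ?t \<omega> \<in> gate_set \<Phi> x g \<and> (\<lambda>s. Z s \<omega>, ?O \<omega>) \<in> B' \<times> {x}} \<in> events"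
    using sets.Int[OF measurable_sets[OF U E] measurable_sets[OF W C]]
    by (rule back_subst[where P="\<lambda>A. A \<in> events"]) auto
  \<comment> \<open>Almost surely, the last gate is \<open>g\<close> exactly when the noise lies in
    \<open>gate_set \<Phi> x g\<close>, given the past \<open>x\<close>. The last observation is
    then \<open>y\<close> exactly when \<open>Z\<close> satisfies the extra constraint in
    \<open>B'\<close>. This separates the noise from the pair of \<open>Z\<close> and the
    past.\<close>
  have "prob {\<omega> \<in> space M. observations G Y (length (x @ [a])) \<omega> = x @ [a] \<and> (\<lambda>s. Z s \<omega>) \<in> B}
      = prob {\<omega> \<in> space M. U ?t \<omega> \<in> gate_set \<Phi> x g \<and> (\<lambda>s. Z s \<omega>, ?O \<omega>) \<in> B' \<times> {x}}"
    using obs[of ?t] gate[of ?t] unit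
    by (intro finite_measure_eq_AE s1 s2, eventually_elim)
       (auto simp: observations_Suc a B'_def gate_set_def)
  also have "\<dots> = prob {\<omega> \<in> space M. U ?t \<omega> \<in> gate_set \<Phi> x g}
                 * prob {\<omega> \<in> space M. (\<lambda>s. Z s \<omega>, ?O \<omega>) \<in> B' \<times> {x}}"
    by (rule independent_rvs_prob[OF prob_space_axioms ind E C])
  also have "prob {\<omega> \<in> space M. U ?t \<omega> \<in> gate_set \<Phi> x g} = measure ?\<mu> (gate_set \<Phi> x g)"
    unfolding unif[of ?t, symmetric] using U E by (simp add: measure_distr vimage_def Int_def conj_commute)
  also have "{\<omega> \<in> space M. (\<lambda>s. Z s \<omega>, ?O \<omega>) \<in> B' \<times> {x}} = {\<omega> \<in> space M. ?O \<omega> = x \<and> (\<lambda>s. Z s \<omega>) \<in> B'}"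
    by auto
  also have "prob \<dots> = gate_prob \<Phi> x * prob {\<omega> \<in> space M. (\<lambda>s. Z s \<omega>) \<in> B' \<and>
                           (\<forall>s<length x. snd (x ! s) = (fst (x ! s) \<and> Z s \<omega>))}"
    using B' by (rule snoc.IH)
  also have "{\<omega> \<in> space M. (\<lambda>s. Z s \<omega>) \<in> B' \<and> (\<forall>s<length x. snd (x ! s) = (fst (x ! s) \<and> Z s \<omega>))}
      = {\<omega> \<in> space M. (\<lambda>s. Z s \<omega>) \<in> B \<and>
          (\<forall>s<length (x @ [a]). snd ((x @ [a]) ! s) = (fst ((x @ [a]) ! s) \<and> Z s \<omega>))}"
    by (auto simp: B'_def a nth_append less_Suc_eq)
  finally show ?case
    by (simp add: gate_prob_append a mult_ac)
qed

section \<open>Reduction to the phasewise counts\<close>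

text \<open>In phase \<open>r\<close> the entry of \<open>v\<close> is read as (open gates, detected
  events). The truncated subtraction counts open gates without event as long as events do not exceed
  open gates.\<close>

definition bernoulli_likelihood :: "nat \<Rightarrow> (nat \<Rightarrow> real) \<Rightarrow> (nat \<times> nat) list \<Rightarrow> real" where
  "bernoulli_likelihood K p v =
     (\<Prod>r<K. p r ^ snd (v ! r) * (1 - p r) ^ (fst (v ! r) - snd (v ! r)))"

text \<open>The path itself takes the role of the outcome in \<open>phase_counts\<close>, which
  exhibits the statistic as a function of the data.\<close>

definition path_counts :: "nat \<Rightarrow> nat \<Rightarrow> (bool \<times> bool) list \<Rightarrow> (nat \<times> nat) list" where
  "path_counts K T x = phase_counts K (\<lambda>t x. fst (x ! t)) (\<lambda>t x. snd (x ! t)) T x"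

lemma phase_counts_observations:
  "phase_counts K G Y T \<omega> = path_counts K T (observations G Y T \<omega>)"
  by (simp add: path_counts_def phase_counts_def phase_count_def observations_def)

lemma length_path_counts [simp]: "length (path_counts K T x) = K"
  by (simp add: path_counts_def phase_counts_def)

lemma periodic_mod:
  fixes p :: "nat \<Rightarrow> 'a" and K :: nat
  assumes "\<And>t. p (t + K) = p t"
  shows "p (t mod K) = p t"
proof -
  have "p (r + k * K) = p r" for r k
    by (induction k) (use assms in \<open>simp_all add: add.assoc[symmetric] add.commute[of K]\<close>)
  from this[of "t mod K" "t div K"] show ?thesis
    by simp
qed

text \<open>Grouping times by residue modulo \<open>K\<close> makes the success probability constant
  in each group, so exponents add up. A closed gate has both exponents 0 and contributes the factor
  1.\<close>

lemma prod_bernoulli_eq_likelihood: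
  assumes "K \<ge> 1" and per: "\<And>t. p (t + K) = p t"
    and le: "\<And>t. t < T \<Longrightarrow> snd (x ! t) \<Longrightarrow> fst (x ! t)"
  shows "(\<Prod>t<T. if fst (x ! t) then if snd (x ! t) then p t else 1 - p t else 1)
       = bernoulli_likelihood K p (path_counts K T x)"
proof -
  let ?S = "\<lambda>r. {t. t < T \<and> t mod K = r}"
  let ?g = "\<lambda>t. of_bool (fst (x ! t)) :: nat" and ?y = "\<lambda>t. of_bool (snd (x ! t)) :: nat"
  let ?f = "\<lambda>t. if fst (x ! t) then if snd (x ! t) then p t else 1 - p t else 1"
  have "(\<Prod>t<T. ?f t) = (\<Prod>r<K. \<Prod>t\<in>{t \<in> {..<T}. t mod K = r}. ?f t)"
    using assms(1) by (intro prod.group[symmetric]) auto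
  also have "\<dots> = (\<Prod>r<K. p r ^ (\<Sum>t\<in>?S r. ?y t) * (1 - p r) ^ ((\<Sum>t\<in>?S r. ?g t) - (\<Sum>t\<in>?S r. ?y t)))"
  proof (rule prod.cong[OF refl])
    fix r
    have "(\<Prod>t\<in>{t \<in> {..<T}. t mod K = r}. ?f t) = (\<Prod>t\<in>?S r. p r ^ ?y t * (1 - p r) ^ (?g t - ?y t))"
      using le periodic_mod[of p, OF per] by (intro prod.cong) auto
    also have "\<dots> = p r ^ (\<Sum>t\<in>?S r. ?y t) * (1 - p r) ^ (\<Sum>t\<in>?S r. ?g t - ?y t)"
      by (simp add: prod.distrib power_sum del: sum_of_bool_eq)
    \<comment> \<open>Truncated subtraction commutes with the sum because an event requires an open
      gate, so no term is cut off at 0.\<close>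
    also have "(\<Sum>t\<in>?S r. ?g t - ?y t) = (\<Sum>t\<in>?S r. ?g t) - (\<Sum>t\<in>?S r. ?y t)"
      using le by (intro sum_subtractf_nat) auto
    finally show "(\<Prod>t\<in>{t \<in> {..<T}. t mod K = r}. ?f t) =
        p r ^ (\<Sum>t\<in>?S r. ?y t) * (1 - p r) ^ ((\<Sum>t\<in>?S r. ?g t) - (\<Sum>t\<in>?S r. ?y t))" .
  qed
  finally show ?thesis
    by (simp add: bernoulli_likelihood_def path_counts_def phase_counts_def phase_count_def)
qed

text \<open>An open gate prescribes the value of \<open>Z s\<close>, while a closed gate imposes no
  condition, since \<open>le\<close> excludes an event there. Independence multiplies the marginal
  probabilities.\<close>

lemma (in prob_space) prob_bernoulli_events:
  assumes Z: "indep_vars (\<lambda>_. count_space UNIV) Z UNIV"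
    and law: "\<And>t. distr M (count_space UNIV) (Z t) = measure_pmf (bernoulli_pmf (p t))"
    and p: "\<And>t. p t \<in> {0..1}"
    and le: "\<And>t. t < T \<Longrightarrow> snd (x ! t) \<Longrightarrow> fst (x ! t)"
  shows "prob {\<omega> \<in> space M. \<forall>s<T. snd (x ! s) = (fst (x ! s) \<and> Z s \<omega>)}
       = (\<Prod>t<T. if fst (x ! t) then if snd (x ! t) then p t else 1 - p t else 1)"
\<comment> \<open>For \<open>T = 0\<close> the intersection used below has an empty index set and
  would not be \<open>space M\<close>.\<close>
proof (cases "T = 0")
  case True
  then show ?thesis by (simp add: prob_space)
next
  case False
  let ?E = "\<lambda>s. {b. snd (x ! s) = (fst (x ! s) \<and> b)}"
  have Zm: "Z s \<in> M \<rightarrow>\<^sub>M count_space UNIV" for s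
    using Z by (simp add: indep_vars_def)
  have "{\<omega> \<in> space M. \<forall>s<T. snd (x ! s) = (fst (x ! s) \<and> Z s \<omega>)} = (\<Inter>s\<in>{..<T}. Z s -` ?E s \<inter> space M)"
    using False by auto
  also have "prob \<dots> = (\<Prod>s<T. prob (Z s -` ?E s \<inter> space M))"
    using False by (intro indep_varsD[OF Z]) auto
  also have "\<dots> = (\<Prod>t<T. if fst (x ! t) then if snd (x ! t) then p t else 1 - p t else 1)"
  proof (rule prod.cong[OF refl])
    fix t assume "t \<in> {..<T}"
    have "prob (Z t -` ?E t \<inter> space M) = measure_pmf.prob (bernoulli_pmf (p t)) (?E t)"
      using Zm by (simp add: law[symmetric] measure_distr)
    also have "\<dots> = measure_pmf.prob (bernoulli_pmf (p t)) (if fst (x ! t) then {snd (x ! t)} else UNIV)"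
      using le[of t] \<open>t \<in> {..<T}\<close> by (intro arg_cong[where f="measure_pmf.prob _"]) auto
    also have "\<dots> = (if fst (x ! t) then if snd (x ! t) then p t else 1 - p t else 1)"
      using p[of t] by (cases "snd (x ! t)") (auto simp: measure_pmf_single)
    finally show "prob (Z t -` ?E t \<inter> space M) =
        (if fst (x ! t) then if snd (x ! t) then p t else 1 - p t else 1)" .
  qed
  finally show ?thesis .
qed

section \<open>Sufficiency of the phasewise counts\<close>

theorem proposition1:
  fixes F :: "'w measure"
    and K D T :: nat
    and \<Theta> :: "(real ^ 'd) set"
    and p :: "nat \<Rightarrow> real ^ 'd \<Rightarrow> real"
    and P :: "real ^ 'd \<Rightarrow> 'w measure"
    and G Y :: "nat \<Rightarrow> 'w \<Rightarrow> bool"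
  assumes "DED_process F K D \<Theta> p P G Y"
  shows "sufficient_statistic \<Theta> F P
           (count_space {x. length x = T}) (observations G Y T)
           (count_space {v. length v = K}) (phase_counts K G Y T)"
proof -
  interpret DED_process F K D \<Theta> p P G Y by fact
  \<comment> \<open>The maps are fixed before any parameter, so that \<open>c\<close> below is one
    function for all \<theta>; \<open>Z\<close> and \<open>U\<close> are chosen later, for each
    \<theta> separately.\<close>
  obtain \<Phi> where \<Phi>:
      "\<And>t. \<Phi> t \<in> count_space {h. length h = t} \<Otimes>\<^sub>M restrict_space borel {0..1} \<rightarrow>\<^sub>M count_space UNIV"
    and causal: "\<And>\<theta>. \<theta> \<in> \<Theta> \<Longrightarrow> \<exists>(Z :: nat \<Rightarrow> 'w \<Rightarrow> bool) (U :: nat \<Rightarrow> 'w \<Rightarrow> real).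
            prob_space.indep_vars (P \<theta>) (\<lambda>_. count_space UNIV) Z UNIV \<and>
            (\<forall>t. distr (P \<theta>) (count_space UNIV) (Z t) = measure_pmf (bernoulli_pmf (p t \<theta>))) \<and>
            (\<forall>t. AE \<omega> in P \<theta>. Y t \<omega> \<longleftrightarrow> G t \<omega> \<and> Z t \<omega>) \<and>
            (\<forall>t. U t \<in> borel_measurable (P \<theta>)) \<and>
            (\<forall>t. distr (P \<theta>) borel (U t) = uniform_measure lborel {0..1}) \<and>
            (\<forall>t. independent_rvs (P \<theta>) borel (U t)
                   ((\<Pi>\<^sub>M s\<in>UNIV. count_space UNIV) \<Otimes>\<^sub>M count_space UNIV)
                   (\<lambda>\<omega>. (\<lambda>s. Z s \<omega>, observations G Y t \<omega>))) \<and>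
            (\<forall>t. AE \<omega> in P \<theta>. G t \<omega> = \<Phi> t (observations G Y t \<omega>, U t \<omega>))"
    using observation_causality by blast
  \<comment> \<open>The counts cannot detect an impossible pair \<open>(g, y) = (0, 1)\<close>, so that constraint is put into \<open>c\<close>.\<close>
  define c where "c x = of_bool (\<forall>t<T. snd (x ! t) \<longrightarrow> fst (x ! t)) * gate_prob \<Phi> x" for x
  show ?thesis
  proof (rule fisher_neyman_factorization[where c=c and h="path_counts K T" and
        q="\<lambda>\<theta>. bernoulli_likelihood K (\<lambda>t. p t \<theta>)"])
    show "finite {x :: (bool \<times> bool) list. length x = T}"
      using finite_lists_length_eq[of "UNIV :: (bool \<times> bool) set" T] by simp
    show "{x :: (bool \<times> bool) list. length x = T} \<noteq> {}"
      using Ex_list_of_length[of T] by auto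
    show "observations G Y T \<in> F \<rightarrow>\<^sub>M count_space {x. length x = T}"
      using G_measurable Y_measurable by (rule observations_measurable)
    show "0 \<le> c x" for x
      by (simp add: c_def gate_prob_def prod_nonneg)
    fix \<theta> and x :: "(bool \<times> bool) list" assume \<theta>: "\<theta> \<in> \<Theta>" and "x \<in> {x. length x = T}"
    then have x: "length x = T" by simp
    interpret prob_space "P \<theta>" by (rule prob_space_P) fact
    have sp: "space (P \<theta>) = space F"
      using sets_P[OF \<theta>] by (rule sets_eq_imp_space_eq)
    from causal[OF \<theta>] obtain Z U where
      Z: "indep_vars (\<lambda>_. count_space UNIV) Z UNIV"
        "\<And>t. distr (P \<theta>) (count_space UNIV) (Z t) = measure_pmf (bernoulli_pmf (p t \<theta>))"
      and ZU: "\<And>t. AE \<omega> in P \<theta>. Y t \<omega> \<longleftrightarrow> G t \<omega> \<and> Z t \<omega>"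
        "\<And>t. U t \<in> borel_measurable (P \<theta>)"
        "\<And>t. distr (P \<theta>) borel (U t) = uniform_measure lborel {0..1}"
        "\<And>t. independent_rvs (P \<theta>) borel (U t)
                   ((\<Pi>\<^sub>M s\<in>UNIV. count_space UNIV) \<Otimes>\<^sub>M count_space UNIV)
                   (\<lambda>\<omega>. (\<lambda>s. Z s \<omega>, observations G Y t \<omega>))"
        "\<And>t. AE \<omega> in P \<theta>. G t \<omega> = \<Phi> t (observations G Y t \<omega>, U t \<omega>)"
      by blast
    have GY: "G t \<in> P \<theta> \<rightarrow>\<^sub>M count_space UNIV" "Y t \<in> P \<theta> \<rightarrow>\<^sub>M count_space UNIV" for t
      using G_measurable Y_measurable sets_P[OF \<theta>] by (simp_all cong: measurable_cong_sets)
    have Zm: "Z t \<in> P \<theta> \<rightarrow>\<^sub>M count_space UNIV" for t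
      using Z(1) by (simp add: indep_vars_def)
    \<comment> \<open>With \<open>B\<close> the whole sequence space, the strengthened induction
      statement reduces to the plain path probability.\<close>
    have "UNIV \<in> sets (\<Pi>\<^sub>M s\<in>(UNIV :: nat set). count_space (UNIV :: bool set))"
      using sets.top[of "\<Pi>\<^sub>M s\<in>(UNIV :: nat set). count_space (UNIV :: bool set)"]
      by (simp add: space_PiM)
    from prob_path_and_events[OF \<Phi> GY Zm ZU this, of x]
    have path: "prob (observations G Y T -` {x} \<inter> space F) =
        gate_prob \<Phi> x * prob {\<omega> \<in> space (P \<theta>). \<forall>s<T. snd (x ! s) = (fst (x ! s) \<and> Z s \<omega>)}"
      by (simp add: x sp vimage_def Int_def conj_commute)
    show "prob (observations G Y T -` {x} \<inter> space F)
        = c x * bernoulli_likelihood K (\<lambda>t. p t \<theta>) (path_counts K T x)"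
    proof (cases "\<forall>t<T. snd (x ! t) \<longrightarrow> fst (x ! t)")
      case True
      then have le: "\<And>t. t < T \<Longrightarrow> snd (x ! t) \<Longrightarrow> fst (x ! t)" by blast
      show ?thesis
        using True path prob_bernoulli_events[OF Z p_range[OF \<theta>] le]
          prod_bernoulli_eq_likelihood[of K "\<lambda>t. p t \<theta>", OF period_pos p_periodic[OF \<theta>] le]
        by (simp add: c_def)
    next
      case False
      \<comment> \<open>A recorded event at a closed gate satisfies the constraint for no value of
        \<open>Z\<close>, so both sides are 0.\<close>
      then have "{\<omega> \<in> space (P \<theta>). \<forall>s<T. snd (x ! s) = (fst (x ! s) \<and> Z s \<omega>)} = {}"
        by auto
      with False path show ?thesis by (simp add: c_def)
    qed
  qed (simp_all add: prob_space_P sets_P phase_counts_observations)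
qed

end
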